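(* Let $p$ be a prime, $m\ge 1$, and $e_1\ge e_2\ge\cdots\ge e_m\ge 1$ integers, and let $G=\bigoplus_{j=1}^m\mathbb{Z}_{p^{e_j}}$, so $|G|=\prod_{j=1}^m p^{e_j}$. For every sequence $(g_k)_{k=1}^{|G|}$ of $|G|$ elements of $G$ there is a nonempty subsequence $(g_k)_{k\in K}$ (with $\emptyset\neq K\subseteq\{1,\dots,|G|\}$) such that $\sum_{k\in K}g_k=0_G$ and $\sum_{k\in K}1/|g_k|\le 1$.
   Context: $\mathbb{Z}_n$ denotes the cyclic group of order $n$; $|g|$ denotes the order of an element $g\in G$ and $0_G$ the identity of $G$. Sequences may contain repeated elements. *)

theory Defs
  imports Complex_Main "HOL-Algebra.Product_Groups" "HOL-Algebra.Multiplicative_Group"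
    "HOL-Computational_Algebra.Primes"
begin

end

theory Submission
  imports Defs "HOL-Library.Disjoint_Sets"
begin

text \<open>
  The cyclic subgroups of an abelian \<open>p\<close>-group form a tree rooted at the trivial subgroup, in which
  the parent of a subgroup of order \<open>p ^ Suc k\<close> is its subgroup of order \<open>p ^ k\<close>. Regard an index set
  whose product lies in \<open>C\<close> and whose cross number is at most \<open>1 / card C\<close> as a pebble on \<open>C\<close>; every
  term of the sequence is a pebble on the subgroup that it generates. By the pigeonhole principle,
  among \<open>p\<close> disjoint pebbles on a vertex there are some whose union is a pebble on the parent. If
  the root receives no pebble, then a vertex of order \<open>p ^ k\<close> receives fewer than \<open>p ^ k\<close> of them,
  so that at most \<open>p ^ k - p ^ (k - 1)\<close> are lost on the way to its parent. This is the number of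
  generators of the vertex. Every element other than the identity generates exactly one vertex
  other than the root, and hence the sequence has fewer than \<open>order G\<close> terms.
\<close>

section \<open>Direct sums of groups\<close>

lemma order_sum_group:
  assumes "finite I" "\<And>i. i \<in> I \<Longrightarrow> group (H i)"
  shows "order (sum_group I H) = (\<Prod>i\<in>I. order (H i))"
proof -
  have "carrier (sum_group I H) = (\<Pi>\<^sub>E i\<in>I. carrier (H i))"
    using assms by (simp add: carrier_sum_group)
  then show ?thesis
    using assms(1) by (simp add: order_def card_PiE)
qed

lemma comm_group_sum_group:
  assumes "\<And>i. i \<in> I \<Longrightarrow> comm_group (H i)"
  shows "comm_group (sum_group I H)"
proof (rule group.group_comm_groupI)
  have grp: "group (H i)" if "i \<in> I" for i
    using assms[OF that] by (rule comm_group.axioms(2))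
  then show "group (sum_group I H)"
    by simp
  fix x y assume "x \<in> carrier (sum_group I H)" "y \<in> carrier (sum_group I H)"
  then have "x i \<in> carrier (H i)" "y i \<in> carrier (H i)" if "i \<in> I" for i
    using that grp by (auto simp: carrier_sum_group)
  then show "x \<otimes>\<^bsub>sum_group I H\<^esub> y = y \<otimes>\<^bsub>sum_group I H\<^esub> x"
    using assms by (auto intro!: restrict_ext comm_monoid.m_comm comm_group.axioms(1))
qed

section \<open>Subgroups of finite cyclic groups\<close>

context group
begin

lemma card_subgroup_pos: "subgroup H G \<Longrightarrow> finite H \<Longrightarrow> card H > 0"
  using subgroup.one_closed card_gt_0_iff by blast

lemma card_subgroup_dvd:
  assumes H: "subgroup H G" and K: "subgroup K G" and "H \<subseteq> K"
  shows "card H dvd card K"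
proof -
  interpret K: group "G\<lparr>carrier := K\<rparr>"
    using K by (rule subgroup_imp_group)
  have "subgroup H (G\<lparr>carrier := K\<rparr>)"
    using assms by (rule subgroup_incl)
  from K.lagrange[OF this] have "card K = card (rcosets\<^bsub>G\<lparr>carrier := K\<rparr>\<^esub> H) * card H"
    by (simp add: order_def)
  then show ?thesis
    by simp
qed

lemma pow_card_subgroup_eq_one:
  assumes H: "subgroup H G" and "y \<in> H"
  shows "y [^] card H = \<one>"
proof -
  have y: "y \<in> carrier G"
    using assms subgroup.mem_carrier by metis
  have "generate G {y} \<subseteq> H"
    using assms by (intro generate_subgroup_incl) auto
  then have "ord y dvd card H"
    using card_subgroup_dvd[OF _ H] y generate_is_subgroup[of "{y}"] generate_pow_card[OF y] by simp
  then show ?thesis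
    using y by (simp add: pow_eq_id)
qed

lemma ord_pow_ord_div:
  assumes "x \<in> carrier G" "ord x > 0" "n dvd ord x"
  shows "ord (x [^] (ord x div n)) = n"
proof -
  have "ord (x [^] (ord x div n)) = ord x div (ord x div n)"
    using assms by (intro ord_pow) (auto simp: dvd_div_eq_0_iff)
  also have "\<dots> = n"
    using assms by (auto elim!: dvdE)
  finally show ?thesis .
qed

lemma generate_pow_ord_div:
  assumes x: "x \<in> carrier G" "ord x > 0" and "n dvd ord x"
  shows "generate G {x [^] (ord x div n)} = {y \<in> generate G {x}. y [^] n = \<one>}"
    (is "generate G {?z} = ?R")
proof
  have z: "?z \<in> carrier G" "ord ?z = n"
    using assms by (simp_all add: ord_pow_ord_div)
  show "generate G {?z} \<subseteq> ?R"
  proof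
    fix y assume y: "y \<in> generate G {?z}"
    have "?z \<in> generate G {x}"
      using generate_pow_nat[OF x(1)] x(2) by auto
    then have "generate G {?z} \<subseteq> generate G {x}"
      using x by (intro generate_subgroup_incl generate_is_subgroup) auto
    moreover have "y [^] n = \<one>"
      using pow_card_subgroup_eq_one[OF generate_is_subgroup y] generate_pow_card[OF z(1)] z by simp
    ultimately show "y \<in> ?R"
      using y by blast
  qed
  show "?R \<subseteq> generate G {?z}"
  proof
    fix y assume "y \<in> ?R"
    then obtain i :: nat where i: "y = x [^] i" "y [^] n = \<one>"
      using generate_pow_nat[OF x(1)] x(2) by auto
    then have "ord x dvd i * n"
      using x by (simp add: nat_pow_pow pow_eq_id)
    then have "ord x div n dvd i"
      using assms by (auto elim!: dvdE)
    then obtain j where "i = ord x div n * j" ..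
    then have "y = ?z [^] j"
      using i x by (simp add: nat_pow_pow)
    then show "y \<in> generate G {?z}"
      using generate_pow_nat[OF z(1)] z(2) assms by (auto dest: dvd_pos_nat)
  qed
qed

lemma subgroup_of_cyclic_eq:
  assumes x: "x \<in> carrier G" "ord x > 0" and H: "subgroup H G" "H \<subseteq> generate G {x}"
  shows "H = {y \<in> generate G {x}. y [^] card H = \<one>}" (is "H = ?R")
proof (rule card_seteq)
  have gen: "subgroup (generate G {x}) G" "card (generate G {x}) = ord x"
    using x by (simp_all add: generate_is_subgroup generate_pow_card)
  then show "finite ?R"
    using x(2) card_ge_0_finite[of "generate G {x}"] by simp
  show "H \<subseteq> ?R"
    using H pow_card_subgroup_eq_one by auto
  have dvd: "card H dvd ord x"
    using card_subgroup_dvd[OF H(1) gen(1) H(2)] gen(2) by simp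
  have "card ?R = ord (x [^] (ord x div card H))"
    using x by (simp flip: generate_pow_ord_div[OF x dvd] add: generate_pow_card)
  then show "card ?R \<le> card H"
    using ord_pow_ord_div[OF x dvd] by simp
qed

lemma subgroup_of_cyclic_subset_iff:
  assumes x: "x \<in> carrier G" "ord x > 0"
    and H: "subgroup H G" "H \<subseteq> generate G {x}" and K: "subgroup K G" "K \<subseteq> generate G {x}"
  shows "H \<subseteq> K \<longleftrightarrow> card H dvd card K"
proof
  assume dvd: "card H dvd card K"
  show "H \<subseteq> K"
  proof
    fix y assume "y \<in> H"
    then have y: "y \<in> generate G {x}" "y \<in> carrier G" "y [^] card H = \<one>"
      using H subgroup.mem_carrier[OF H(1)] pow_card_subgroup_eq_one by auto
    then have "y [^] card K = \<one>"
      using dvd dvd_trans by (auto simp: pow_eq_id)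
    then show "y \<in> K"
      using subgroup_of_cyclic_eq[OF x K] y by blast
  qed
qed (rule card_subgroup_dvd[OF H(1) K(1)])

end

section \<open>Products of consecutive terms\<close>

context comm_group
begin

lemma finprod_subgroup_closed:
  assumes "subgroup H G" "f \<in> A \<rightarrow> H"
  shows "finprod G f A \<in> H"
  using assms(2)
proof (induction A rule: infinite_finite_induct)
  case (insert a A)
  then have "f \<in> A \<rightarrow> carrier G" "f a \<in> carrier G"
    using subgroup.mem_carrier[OF assms(1)] by auto
  then show ?case
    using insert subgroup.m_closed[OF assms(1)] by auto
qed (use subgroup.one_closed[OF assms(1)] in auto)

lemma not_inj_on_r_coset:
  assumes C: "subgroup C G" and D: "subgroup D G" and "C \<subseteq> D" "finite D"
    and P: "P \<in> A \<rightarrow> D" and card: "card D < card A * card C"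
  shows "\<not> inj_on (\<lambda>j. C #> P j) A"
proof
  assume inj: "inj_on (\<lambda>j. C #> P j) A"
  interpret D: group "G\<lparr>carrier := D\<rparr>"
    using D by (rule subgroup_imp_group)
  have CD: "subgroup C (G\<lparr>carrier := D\<rparr>)"
    using C D \<open>C \<subseteq> D\<close> by (rule subgroup_incl)
  have "(\<lambda>j. C #> P j) ` A \<subseteq> rcosets\<^bsub>G\<lparr>carrier := D\<rparr>\<^esub> C"
    using P by (fastforce simp: RCOSETS_def r_coset_def)
  moreover have "finite (rcosets\<^bsub>G\<lparr>carrier := D\<rparr>\<^esub> C)"
    using \<open>finite D\<close> by (simp add: RCOSETS_def)
  ultimately have "card A \<le> card (rcosets\<^bsub>G\<lparr>carrier := D\<rparr>\<^esub> C)"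
    using inj card_inj_on_le by blast
  then have "card A * card C \<le> card (rcosets\<^bsub>G\<lparr>carrier := D\<rparr>\<^esub> C) * card C"
    by (rule mult_le_mono1)
  also have "\<dots> = card D"
    using D.lagrange[OF CD] by (simp add: order_def)
  finally show False
    using card by simp
qed

lemma exists_consecutive_finprod_in_subgroup:
  assumes C: "subgroup C G" and D: "subgroup D G" and "C \<subseteq> D" "finite D"
    and f: "f \<in> {m..<m + n} \<rightarrow> D" and card: "card D \<le> n * card C"
  shows "\<exists>i j. m \<le> i \<and> i < j \<and> j \<le> m + n \<and> finprod G f {i..<j} \<in> C"
proof -
  define P where "P j = finprod G f {m..<j}" for j
  have "P j \<in> D" if "j \<in> {m..m + n}" for j
    unfolding P_def by (rule finprod_subgroup_closed[OF D]) (use that f in auto)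
  then have "P \<in> {m..m + n} \<rightarrow> D"
    by blast
  moreover have "card D < card {m..m + n} * card C"
    using card card_subgroup_pos[OF C] \<open>C \<subseteq> D\<close> \<open>finite D\<close> by (simp add: finite_subset)
  ultimately have "\<not> inj_on (\<lambda>j. C #> P j) {m..m + n}"
    by (rule not_inj_on_r_coset[OF C D \<open>C \<subseteq> D\<close> \<open>finite D\<close>])
  then obtain i j where ij: "m \<le> i" "i < j" "j \<le> m + n" "C #> P i = C #> P j"
    using linorder_inj_onI'[of "{m..m + n}" "\<lambda>j. C #> P j"] by fastforce
  let ?y = "finprod G f {i..<j}"
  have fG: "f \<in> {m..<m + n} \<rightarrow> carrier G"
    using f subgroup.mem_carrier[OF D] by auto
  then have carr: "P i \<in> carrier G" "P j \<in> carrier G" "?y \<in> carrier G"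
    unfolding P_def using ij by (auto intro!: finprod_closed)
  have "{m..<j} = {m..<i} \<union> {i..<j}"
    using ij by auto
  then have "P j = P i \<otimes> ?y"
    unfolding P_def using fG ij by (simp add: finprod_Un_disjoint Pi_def)
  moreover have "P j \<in> C #> P i"
    using ij(4) rcos_self[OF carr(2) C] by simp
  then obtain c where c: "c \<in> C" "P j = c \<otimes> P i"
    by (auto simp: r_coset_def)
  ultimately have "?y \<otimes> P i = c \<otimes> P i"
    using carr by (simp add: m_comm)
  then have "?y = c"
    using carr c subgroup.mem_carrier[OF C] by simp
  then show ?thesis
    using ij c by blast
qed

end

section \<open>Pebbles\<close>

lemma block_subset_lessThan:
  fixes p s j :: nat
  assumes "j < s div p"
  shows "{p * j..<p * j + p} \<subseteq> {..<s}"
proof -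
  have "p * Suc j \<le> p * (s div p)"
    using assms by (intro mult_le_mono2) simp
  also have "\<dots> \<le> s"
    by simp
  finally show ?thesis
    by auto
qed

lemma disjoint_family_blocks: "disjoint_family (\<lambda>j. {p * j..<p * j + p :: nat})"
proof -
  have "i div p = j" if "i \<in> {p * j..<p * j + p}" for i j
    using that by (intro div_nat_eqI) auto
  then show ?thesis
    unfolding disjoint_family_on_def by blast
qed

context comm_group
begin

definition cross_number :: "('i \<Rightarrow> 'a) \<Rightarrow> 'i set \<Rightarrow> real" where
  "cross_number g K = (\<Sum>k\<in>K. 1 / real (ord (g k)))"

definition pebble :: "('i \<Rightarrow> 'a) \<Rightarrow> 'a set \<Rightarrow> 'i set \<Rightarrow> bool" where
  "pebble g C K \<longleftrightarrow> finite K \<and> K \<noteq> {} \<and> finprod G g K \<in> C \<and> cross_number g K \<le> 1 / real (card C)"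

definition has_pebbles :: "('i \<Rightarrow> 'a) \<Rightarrow> 'a set \<Rightarrow> 'i set \<Rightarrow> nat \<Rightarrow> bool" where
  "has_pebbles g C I s \<longleftrightarrow>
     (\<exists>F. disjoint_family_on F {..<s} \<and> (\<forall>i<s. F i \<subseteq> I \<and> pebble g C (F i)))"

lemma pebble_singleton:
  assumes "g i \<in> carrier G"
  shows "pebble g (generate G {g i}) {i}"
  using assms generate.incl[of "g i" "{g i}" G]
  by (simp add: pebble_def cross_number_def generate_pow_card)

lemma pebble_UN:
  assumes A: "finite A" "A \<noteq> {}" "card A * card C \<le> card D" and "card C > 0"
    and F: "disjoint_family_on F A" "\<And>i. i \<in> A \<Longrightarrow> pebble g D (F i)"
    and g: "\<And>i. i \<in> A \<Longrightarrow> g \<in> F i \<rightarrow> carrier G"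
    and prod: "finprod G (\<lambda>i. finprod G g (F i)) A \<in> C"
  shows "pebble g C (\<Union>i\<in>A. F i)"
proof -
  have fin: "finite (F i)" "F i \<noteq> {}" if "i \<in> A" for i
    using F(2)[OF that] by (simp_all add: pebble_def)
  have "finprod G g (\<Union>i\<in>A. F i) = finprod G (\<lambda>i. finprod G g (F i)) A"
    using A(1) fin F(1) funcset_mem[OF g]
    by (intro finprod_UN_disjoint) (auto simp: disjoint_family_on_def pairwise_def disjnt_def)
  moreover have "cross_number g (\<Union>i\<in>A. F i) \<le> 1 / real (card C)"
  proof -
    have "cross_number g (\<Union>i\<in>A. F i) = (\<Sum>i\<in>A. cross_number g (F i))"
      unfolding cross_number_def using A(1) fin F(1)
      by (intro sum.UNION_disjoint) (auto simp: disjoint_family_on_def)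
    also have "\<dots> \<le> (\<Sum>i\<in>A. 1 / real (card D))"
      using F(2) by (intro sum_mono) (simp add: pebble_def)
    also have "\<dots> = real (card A) / real (card D)"
      by simp
    also have "\<dots> \<le> 1 / real (card C)"
    proof -
      have "card D > 0"
        using A \<open>card C > 0\<close> by (metis card_gt_0_iff less_le_trans mult_pos_pos)
      moreover have "real (card A) * real (card C) \<le> real (card D)"
        using A(3) by (simp flip: of_nat_mult)
      ultimately show ?thesis
        using \<open>card C > 0\<close> by (simp add: divide_simps)
    qed
    finally show ?thesis .
  qed
  ultimately show ?thesis
    using A fin prod by (simp add: pebble_def)
qed

lemma has_pebbles_le:
  assumes "has_pebbles g C I s" "t \<le> s"
  shows "has_pebbles g C I t"
proof -
  obtain F where F: "disjoint_family_on F {..<s}" "\<forall>i<s. F i \<subseteq> I \<and> pebble g C (F i)"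
    using assms(1) unfolding has_pebbles_def by blast
  have "disjoint_family_on F {..<t}"
    using assms(2) by (intro disjoint_family_on_mono[OF _ F(1)]) simp
  then show ?thesis
    unfolding has_pebbles_def using F(2) assms(2) less_le_trans by blast
qed

lemma has_pebblesI:
  assumes "finite A" "disjoint_family_on E A" "\<And>a. a \<in> A \<Longrightarrow> E a \<subseteq> I \<and> pebble g C (E a)"
  shows "has_pebbles g C I (card A)"
proof -
  obtain b where b: "bij_betw b {..<card A} A"
    using ex_bij_betw_nat_finite[OF assms(1)] by (auto simp: atLeast0LessThan)
  have "disjoint_family_on (\<lambda>j. E (b j)) {..<card A}"
    using assms(2) bij_betwE[OF b] bij_betw_imp_inj_on[OF b]
    unfolding disjoint_family_on_def by (meson inj_onD)
  moreover have "b j \<in> A" if "j < card A" for j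
    using b that by (auto simp: bij_betw_def)
  ultimately show ?thesis
    unfolding has_pebbles_def using assms(3) by blast
qed

lemma has_pebbles_singletons:
  assumes "finite I" "\<And>i. i \<in> I \<Longrightarrow> pebble g C {i}"
  shows "has_pebbles g C I (card I)"
  using assms by (intro has_pebblesI[where E = "\<lambda>i. {i}"]) (auto simp: disjoint_family_on_def)

lemma has_pebbles_UN:
  assumes "finite A" "\<And>a. a \<in> A \<Longrightarrow> has_pebbles g C (I a) (s a)" "disjoint_family_on I A"
  shows "has_pebbles g C (\<Union>a\<in>A. I a) (\<Sum>a\<in>A. s a)"
proof -
  have "\<forall>a\<in>A. \<exists>F. disjoint_family_on F {..<s a} \<and> (\<forall>i<s a. F i \<subseteq> I a \<and> pebble g C (F i))"
    using assms(2) by (simp add: has_pebbles_def)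
  then obtain F where F: "\<And>a. a \<in> A \<Longrightarrow> disjoint_family_on (F a) {..<s a}"
    "\<And>a i. a \<in> A \<Longrightarrow> i < s a \<Longrightarrow> F a i \<subseteq> I a \<and> pebble g C (F a i)"
    by (auto dest!: bchoice)
  have disj: "F a i \<inter> F b j = {}"
    if ab: "a \<in> A" "i < s a" "b \<in> A" "j < s b" "(a, i) \<noteq> (b, j)" for a i b j
  proof (cases "a = b")
    case True
    then show ?thesis
      using F(1)[OF ab(1)] ab by (simp add: disjoint_family_on_def)
  next
    case False
    then have "I a \<inter> I b = {}"
      using assms(3) ab by (simp add: disjoint_family_on_def)
    then show ?thesis
      using F(2)[OF ab(1,2)] F(2)[OF ab(3,4)] by blast
  qed
  have "has_pebbles g C (\<Union>a\<in>A. I a) (card (SIGMA a:A. {..<s a}))"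
  proof (rule has_pebblesI)
    show "disjoint_family_on (\<lambda>(a, i). F a i) (SIGMA a:A. {..<s a})"
      unfolding disjoint_family_on_def
    proof (intro ballI impI)
      fix x y assume "x \<in> (SIGMA a:A. {..<s a})" "y \<in> (SIGMA a:A. {..<s a})" "x \<noteq> y"
      then show "(case x of (a, i) \<Rightarrow> F a i) \<inter> (case y of (a, i) \<Rightarrow> F a i) = {}"
        using disj[of "fst x" "snd x" "fst y" "snd y"] by force
    qed
  qed (use assms(1) F(2) in fastforce)+
  then show ?thesis
    using assms(1) by (simp add: card_SigmaI)
qed

lemma has_pebbles_Un:
  assumes "has_pebbles g C I s" "has_pebbles g C J t" "I \<inter> J = {}"
  shows "has_pebbles g C (I \<union> J) (s + t)"
  using has_pebbles_UN[of UNIV g C "\<lambda>b. if b then I else J" "\<lambda>b. if b then s else t"] assms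
  by (simp add: UNIV_bool disjoint_family_on_def Un_commute Int_commute add.commute)

lemma exists_pebble_in_subgroup:
  assumes C: "subgroup C G" and D: "subgroup D G" and "C \<subseteq> D" "finite D"
    and card: "card D = p * card C" and g: "g \<in> I \<rightarrow> carrier G"
    and F: "disjoint_family_on F {m..<m + p}"
      "\<And>i. i \<in> {m..<m + p} \<Longrightarrow> F i \<subseteq> I \<and> pebble g D (F i)"
  shows "\<exists>K \<subseteq> (\<Union>i\<in>{m..<m + p}. F i). pebble g C K"
proof -
  have "(\<lambda>i. finprod G g (F i)) \<in> {m..<m + p} \<rightarrow> D"
    using F(2) by (auto simp: pebble_def)
  from exists_consecutive_finprod_in_subgroup[OF C D \<open>C \<subseteq> D\<close> \<open>finite D\<close> this] card
  obtain i j where ij: "m \<le> i" "i < j" "j \<le> m + p"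
    "finprod G (\<lambda>i. finprod G g (F i)) {i..<j} \<in> C"
    by auto
  then have sub: "{i..<j} \<subseteq> {m..<m + p}"
    by auto
  have "pebble g C (\<Union>k\<in>{i..<j}. F k)"
  proof (rule pebble_UN)
    show "card {i..<j} * card C \<le> card D"
      using card_mono[OF _ sub] card by simp
    show "card C > 0"
      using card_subgroup_pos[OF C] \<open>C \<subseteq> D\<close> \<open>finite D\<close> finite_subset by blast
    show "disjoint_family_on F {i..<j}"
      using sub F(1) by (rule disjoint_family_on_mono)
    show "pebble g D (F k)" "g \<in> F k \<rightarrow> carrier G" if "k \<in> {i..<j}" for k
      using F(2)[of k] sub that g by blast+
  qed (use ij in auto)
  then show ?thesis
    using sub by blast
qed

lemma has_pebbles_div_index:
  assumes "subgroup C G" "subgroup D G" "C \<subseteq> D" "finite D" "card D = p * card C"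
    and "g \<in> I \<rightarrow> carrier G" "has_pebbles g D I s"
  shows "has_pebbles g C I (s div p)"
proof -
  obtain F where F: "disjoint_family_on F {..<s}" "\<And>i. i < s \<Longrightarrow> F i \<subseteq> I \<and> pebble g D (F i)"
    using assms(7) unfolding has_pebbles_def by blast
  let ?B = "\<lambda>j. {p * j..<p * j + p}"
  have B: "?B j \<subseteq> {..<s}" if "j < s div p" for j
    using that by (rule block_subset_lessThan)
  have "\<exists>K \<subseteq> (\<Union>i\<in>?B j. F i). pebble g C K" if "j < s div p" for j
  proof (rule exists_pebble_in_subgroup[OF assms(1-6)])
    show "disjoint_family_on F (?B j)"
      using B[OF that] F(1) by (rule disjoint_family_on_mono)
    show "F i \<subseteq> I \<and> pebble g D (F i)" if "i \<in> ?B j" for i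
      using B[OF \<open>j < s div p\<close>] F(2)[of i] that by blast
  qed
  then obtain E where E: "E j \<subseteq> (\<Union>i\<in>?B j. F i)" "pebble g C (E j)" if "j < s div p" for j
    by metis
  have "disjoint_family_on E {..<s div p}"
    unfolding disjoint_family_on_def
  proof (intro ballI impI)
    fix j k assume jk: "j \<in> {..<s div p}" "k \<in> {..<s div p}" "j \<noteq> k"
    then have "?B j \<inter> ?B k = {}"
      using disjoint_family_onD[OF disjoint_family_blocks] by blast
    then have "F i \<inter> F l = {}" if "i \<in> ?B j" "l \<in> ?B k" for i l
      using disjoint_family_onD[OF F(1)] B[of j] B[of k] that jk by blast
    then show "E j \<inter> E k = {}"
      using E(1)[of j] E(1)[of k] jk by blast
  qed
  moreover have "E j \<subseteq> I" if "j < s div p" for j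
    using E(1)[OF that] B[OF that] F(2) by blast
  ultimately show ?thesis
    unfolding has_pebbles_def using E(2) by blast
qed

end

section \<open>The tree of cyclic subgroups\<close>

lemma le_div_add_diff:
  fixes s p c :: nat
  assumes "s < p * c"
  shows "s \<le> s div p + (p * c - c)"
proof -
  obtain r where r: "p = Suc r"
    using assms by (cases p) auto
  have "s = s div p + r * (s div p) + s mod p"
    using mult_div_mod_eq[of p s] r by simp
  also have "\<dots> \<le> s div p + r * Suc (s div p)"
    using mod_less_divisor[of p s] r by simp
  also have "r * Suc (s div p) \<le> r * c"
    using assms by (intro mult_le_mono2 Suc_leI) (simp add: less_mult_imp_div_less mult.commute)
  finally show ?thesis
    using r by simp
qed

locale finite_abelian_p_group = comm_group +
  fixes p n :: nat
  assumes prime_p: "Factorial_Ring.prime p" and order_eq: "order G = p ^ n"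
begin

lemma p_gt_1: "p > 1"
  using prime_p prime_gt_1_nat by blast

lemma finite_carrier: "finite (carrier G)"
  using order_eq p_gt_1 order_gt_0_iff_finite by force

lemma finite_subgroup: "subgroup H G \<Longrightarrow> finite H"
  using finite_carrier finite_subset subgroup.subset by blast

lemma ord_pos: "x \<in> carrier G \<Longrightarrow> ord x > 0"
  using finite_carrier ord_ge_1 by fastforce

lemma card_subgroup_prime_power:
  assumes "subgroup H G"
  obtains k where "card H = p ^ k"
proof -
  have "card H dvd p ^ n"
    using lagrange[OF assms] order_eq by (metis dvd_triv_right)
  then show ?thesis
    using that divides_primepow_nat[OF prime_p] by blast
qed

lemma prime_mult_card_subgroup_dvd:
  assumes H: "subgroup H G" and K: "subgroup K G" and "\<not> card K dvd card H"
  shows "p * card H dvd card K"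
proof -
  obtain i j where ij: "card H = p ^ i" "card K = p ^ j"
    using card_subgroup_prime_power[OF H] card_subgroup_prime_power[OF K] by metis
  then have "Suc i \<le> j"
    using assms(3) by (metis le_imp_power_dvd not_less_eq_eq)
  then have "p ^ Suc i dvd p ^ j"
    by (rule le_imp_power_dvd)
  then show ?thesis
    using ij by simp
qed

definition elements_above :: "'a set \<Rightarrow> 'a set" where
  "elements_above C = {x \<in> carrier G. C \<subseteq> generate G {x}}"

definition elements_strictly_above :: "'a set \<Rightarrow> 'a set" where
  "elements_strictly_above C = {x \<in> carrier G. C \<subset> generate G {x}}"

definition children :: "'a set \<Rightarrow> 'a set set" where
  "children C = (\<lambda>x. generate G {x}) ` {x \<in> elements_above C. ord x = p * card C}"

lemma finite_elements_above: "finite (elements_above C)"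
  using finite_carrier by (simp add: elements_above_def)

lemma finite_elements_strictly_above: "finite (elements_strictly_above C)"
  using finite_carrier by (simp add: elements_strictly_above_def)

lemma finite_children: "finite (children C)"
  by (simp add: children_def finite_elements_above)

lemma subgroup_child: "D \<in> children C \<Longrightarrow> subgroup D G"
  by (auto simp: children_def elements_above_def intro: generate_is_subgroup)

lemma card_child: "D \<in> children C \<Longrightarrow> card D = p * card C"
  by (auto simp: children_def elements_above_def simp flip: generate_pow_card)

lemma psubset_child:
  assumes "subgroup C G" "D \<in> children C"
  shows "C \<subset> D"
proof -
  have "card C > 0"
    using assms(1) finite_subgroup card_subgroup_pos by blast
  then have "card C \<noteq> card D"
    using card_child[OF assms(2)] p_gt_1 by simp
  then show ?thesis
    using assms(2) by (auto simp: children_def elements_above_def)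
qed

lemma elements_strictly_above_eq_UN_children:
  assumes C: "subgroup C G"
  shows "elements_strictly_above C = (\<Union>D\<in>children C. elements_above D)"
proof
  show "elements_strictly_above C \<subseteq> (\<Union>D\<in>children C. elements_above D)"
  proof
    fix x assume "x \<in> elements_strictly_above C"
    then have x: "x \<in> carrier G" "ord x > 0" and "C \<subset> generate G {x}"
      using ord_pos by (auto simp: elements_strictly_above_def)
    then have gen: "subgroup (generate G {x}) G" "C \<subseteq> generate G {x}" "\<not> generate G {x} \<subseteq> C"
      using generate_is_subgroup by auto
    have "p * card C dvd ord x"
      using prime_mult_card_subgroup_dvd[OF C gen(1)] generate_pow_card[OF x(1)]
        subgroup_of_cyclic_subset_iff[OF x gen(1) order_refl C gen(2)] gen(3) by simp
    then obtain z where z: "z = x [^] (ord x div (p * card C))" "ord z = p * card C"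
      "generate G {z} \<subseteq> generate G {x}"
      using ord_pow_ord_div[OF x] generate_pow_ord_div[OF x] by blast
    then have zG: "z \<in> carrier G"
      using x by simp
    have "C \<subseteq> generate G {z}"
      using subgroup_of_cyclic_subset_iff[OF x C gen(2) generate_is_subgroup z(3)] zG z(2)
        generate_pow_card[OF zG] by simp
    then have "generate G {z} \<in> children C" "x \<in> elements_above (generate G {z})"
      using zG z x by (auto simp: children_def elements_above_def)
    then show "x \<in> (\<Union>D\<in>children C. elements_above D)"
      by blast
  qed
next
  show "(\<Union>D\<in>children C. elements_above D) \<subseteq> elements_strictly_above C"
    using psubset_child[OF C] by (auto simp: elements_above_def elements_strictly_above_def)
qed

lemma disjoint_family_elements_above_children: "disjoint_family_on elements_above (children C)"
  unfolding disjoint_family_on_def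
proof (intro ballI impI equals0I)
  fix D E x
  assume DE: "D \<in> children C" "E \<in> children C" and "D \<noteq> E" "x \<in> elements_above D \<inter> elements_above E"
  then have x: "x \<in> carrier G" "ord x > 0" "D \<subseteq> generate G {x}" "E \<subseteq> generate G {x}"
    using ord_pos by (auto simp: elements_above_def)
  have "D \<subseteq> E \<longleftrightarrow> card D dvd card E" "E \<subseteq> D \<longleftrightarrow> card E dvd card D"
    using subgroup_of_cyclic_subset_iff[OF x(1,2)] x(3,4) DE[THEN subgroup_child] by blast+
  then show False
    using \<open>D \<noteq> E\<close> DE[THEN card_child] by simp
qed

lemma generate_eq_child:
  assumes C: "subgroup C G" and D: "D \<in> children C" and y: "y \<in> D - C"
  shows "generate G {y} = D"
proof -
  obtain x where x: "x \<in> carrier G" "ord x > 0" "D = generate G {x}"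
    using D ord_pos by (auto simp: children_def elements_above_def)
  note D' = subgroup_child[OF D] card_child[OF D] psubset_imp_subset[OF psubset_child[OF C D]]
  have "y \<in> carrier G"
    using y D'(1) subgroup.mem_carrier by fastforce
  then have gen: "subgroup (generate G {y}) G"
    using generate_is_subgroup by simp
  have sub: "generate G {y} \<subseteq> D"
    using y by (intro generate_subgroup_incl D') auto
  have "\<not> generate G {y} \<subseteq> C"
    using y generate.incl[of y "{y}" G] by auto
  then have "p * card C dvd card (generate G {y})"
    using subgroup_of_cyclic_subset_iff[OF x(1,2) gen _ C] sub D'(3) x(3)
      prime_mult_card_subgroup_dvd[OF C gen] by simp
  then have "D \<subseteq> generate G {y}"
    using subgroup_of_cyclic_subset_iff[OF x(1,2) D'(1) _ gen] sub D'(2) x(3) by simp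
  with sub show ?thesis ..
qed

lemma card_elements_above_child:
  assumes C: "subgroup C G" and D: "D \<in> children C"
  shows "card (elements_above D) = card (elements_strictly_above D) + (card D - card C)"
proof -
  note D' = subgroup_child[OF D] psubset_imp_subset[OF psubset_child[OF C D]]
  have "elements_above D = elements_strictly_above D \<union> (D - C)"
  proof
    show "elements_above D \<subseteq> elements_strictly_above D \<union> (D - C)"
    proof
      fix x assume x: "x \<in> elements_above D"
      then have "x \<in> generate G {x}" "x \<in> C \<Longrightarrow> generate G {x} \<subseteq> C"
        using generate_subgroup_incl[OF _ C, of "{x}"] by (auto intro: generate.incl)
      then show "x \<in> elements_strictly_above D \<union> (D - C)"
        using x psubset_child[OF C D] by (auto simp: elements_above_def elements_strictly_above_def)
    qed
  next
    show "elements_strictly_above D \<union> (D - C) \<subseteq> elements_above D"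
      using generate_eq_child[OF C D] subgroup.mem_carrier[OF D'(1)]
      by (auto simp: elements_above_def elements_strictly_above_def)
  qed
  moreover have "elements_strictly_above D \<inter> (D - C) = {}"
    using generate_eq_child[OF C D] by (auto simp: elements_strictly_above_def)
  moreover have "card (D - C) = card D - card C"
    using D' C finite_subgroup by (simp add: card_Diff_subset)
  ultimately show ?thesis
    using finite_elements_strictly_above finite_subgroup[OF D'(1)] by (simp add: card_Un_disjoint)
qed

lemma card_elements_strictly_above:
  assumes "subgroup C G"
  shows "card (elements_strictly_above C) = (\<Sum>D\<in>children C. card (elements_above D))"
  unfolding elements_strictly_above_eq_UN_children[OF assms]
  using finite_elements_above disjoint_family_elements_above_children finite_children
  by (intro card_UN_disjoint) (auto simp: disjoint_family_on_def)

lemma min_card_diff_le_sum_children: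
  fixes c :: "'a set \<Rightarrow> nat"
  assumes C: "subgroup C G"
  shows "min (card C) ((\<Sum>D\<in>children C. c D) - card (elements_strictly_above C))
    \<le> (\<Sum>D\<in>children C. min (card D) (c D - card (elements_strictly_above D)) div p)"
    (is "_ \<le> (\<Sum>D\<in>_. ?s D div p)")
proof (cases "\<exists>D\<in>children C. card C \<le> ?s D div p")
  case True
  then obtain D where D: "D \<in> children C" "card C \<le> ?s D div p"
    by blast
  then have "?s D div p \<le> (\<Sum>D\<in>children C. ?s D div p)"
    using finite_children by (intro member_le_sum) auto
  with D(2) show ?thesis
    by simp
next
  case False
  have "c D \<le> ?s D div p + card (elements_above D)" if D: "D \<in> children C" for D
  proof -
    have less: "?s D < p * card C"
      using False D p_gt_1 by (auto simp: not_le div_less_iff_less_mult mult.commute)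
    then have "c D \<le> ?s D + card (elements_strictly_above D)"
      using card_child[OF D] by simp
    also have "?s D \<le> ?s D div p + (card D - card C)"
      using le_div_add_diff[OF less] card_child[OF D] by simp
    finally show ?thesis
      using card_elements_above_child[OF C D] by simp
  qed
  then have "(\<Sum>D\<in>children C. c D) \<le> (\<Sum>D\<in>children C. ?s D div p + card (elements_above D))"
    by (rule sum_mono)
  then show ?thesis
    by (simp add: sum.distrib card_elements_strictly_above[OF C])
qed

definition indices_at :: "('i \<Rightarrow> 'a) \<Rightarrow> 'i set \<Rightarrow> 'a set \<Rightarrow> 'i set" where
  "indices_at g I C = {i \<in> I. generate G {g i} = C}"

definition indices_above :: "('i \<Rightarrow> 'a) \<Rightarrow> 'i set \<Rightarrow> 'a set \<Rightarrow> 'i set" where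
  "indices_above g I C = {i \<in> I. g i \<in> elements_above C}"

lemma finite_indices_at: "finite I \<Longrightarrow> finite (indices_at g I C)"
  by (simp add: indices_at_def)

lemma finite_indices_above: "finite I \<Longrightarrow> finite (indices_above g I C)"
  by (simp add: indices_above_def)

lemma index_partition_children:
  assumes C: "subgroup C G" and g: "g \<in> I \<rightarrow> elements_above C"
  shows "I = indices_at g I C \<union> (\<Union>D\<in>children C. indices_above g I D)"
    and "indices_at g I C \<inter> (\<Union>D\<in>children C. indices_above g I D) = {}"
    and "disjoint_family_on (indices_above g I) (children C)"
proof -
  have "generate G {g i} = C \<or> g i \<in> elements_strictly_above C" if "i \<in> I" for i
    using g that by (auto simp: elements_above_def elements_strictly_above_def)
  then show "I = indices_at g I C \<union> (\<Union>D\<in>children C. indices_above g I D)"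
    unfolding elements_strictly_above_eq_UN_children[OF C] indices_at_def indices_above_def by blast
  show "indices_at g I C \<inter> (\<Union>D\<in>children C. indices_above g I D) = {}"
    using psubset_child[OF C] by (auto simp: indices_at_def indices_above_def elements_above_def)
  show "disjoint_family_on (indices_above g I) (children C)"
    using disjoint_family_elements_above_children
    by (auto simp: disjoint_family_on_def indices_above_def)
qed

lemma card_eq_sum_children:
  assumes C: "subgroup C G" and "finite I" and g: "g \<in> I \<rightarrow> elements_above C"
  shows "card I = card (indices_at g I C) + (\<Sum>D\<in>children C. card (indices_above g I D))"
proof -
  note partition = index_partition_children[OF C g]
  have "card I = card (indices_at g I C) + card (\<Union>D\<in>children C. indices_above g I D)"
    using \<open>finite I\<close> finite_indices_at finite_indices_above finite_children partition(2)
    by (subst partition(1), intro card_Un_disjoint) auto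
  also have "card (\<Union>D\<in>children C. indices_above g I D)
      = (\<Sum>D\<in>children C. card (indices_above g I D))"
    using \<open>finite I\<close> finite_indices_above finite_children partition(3)
    by (intro card_UN_disjoint) (auto simp: disjoint_family_on_def)
  finally show ?thesis .
qed

lemma has_pebbles_children:
  assumes C: "subgroup C G" and "finite I" and g: "g \<in> I \<rightarrow> elements_above C"
    and s: "\<And>D. D \<in> children C \<Longrightarrow> has_pebbles g D (indices_above g I D) (s D)"
  shows "has_pebbles g C I (card (indices_at g I C) + (\<Sum>D\<in>children C. s D div p))"
proof -
  note partition = index_partition_children[OF C g]
  have gG: "g i \<in> carrier G" if "i \<in> I" for i
    using g that by (auto simp: elements_above_def)
  have "has_pebbles g C (indices_above g I D) (s D div p)" if D: "D \<in> children C" for D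
  proof (rule has_pebbles_div_index[OF C subgroup_child[OF D] _ _ card_child[OF D] _ s[OF D]])
    show "C \<subseteq> D" "finite D"
      using psubset_child[OF C D] finite_subgroup[OF subgroup_child[OF D]] by auto
  qed (use gG in \<open>auto simp: indices_above_def\<close>)
  then have "has_pebbles g C (\<Union>D\<in>children C. indices_above g I D) (\<Sum>D\<in>children C. s D div p)"
    by (intro has_pebbles_UN finite_children partition(3))
  moreover have "has_pebbles g C (indices_at g I C) (card (indices_at g I C))"
    using finite_indices_at[OF \<open>finite I\<close>] gG pebble_singleton[of g]
    by (intro has_pebbles_singletons) (auto simp: indices_at_def)
  ultimately show ?thesis
    by (subst partition(1), intro has_pebbles_Un partition(2))
qed

text \<open>The cap is \<open>card C\<close> because so many pebbles on \<open>C\<close> already yield one on the root.\<close>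

lemma has_pebbles_min_card:
  assumes "subgroup C G" "finite I" "g \<in> I \<rightarrow> elements_above C"
  shows "has_pebbles g C I (min (card C) (card I - card (elements_strictly_above C)))"
  using assms
proof (induction C arbitrary: I rule: measure_induct_rule[of "\<lambda>C. order G - card C"])
  case (less C)
  note C = less.prems(1)
  define c where "c D = card (indices_above g I D)" for D
  define s where "s D = min (card D) (c D - card (elements_strictly_above D))" for D
  have "has_pebbles g D (indices_above g I D) (s D)" if D: "D \<in> children C" for D
  proof -
    note D' = subgroup_child[OF D]
    have "card C < card D" "card D \<le> order G"
      unfolding order_def using psubset_child[OF C D] finite_subgroup[OF D'] subgroup.subset[OF D']
      by (simp_all add: psubset_card_mono card_mono finite_carrier)
    moreover have "g \<in> indices_above g I D \<rightarrow> elements_above D"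
      by (auto simp: indices_above_def)
    ultimately show ?thesis
      unfolding s_def c_def using D' finite_indices_above[OF less.prems(2)] by (intro less.IH) auto
  qed
  then have "has_pebbles g C I (card (indices_at g I C) + (\<Sum>D\<in>children C. s D div p))"
    by (rule has_pebbles_children[OF less.prems])
  moreover have "min (card C) (card I - card (elements_strictly_above C))
      \<le> card (indices_at g I C) + (\<Sum>D\<in>children C. s D div p)"
    using min_card_diff_le_sum_children[OF C, of c] card_eq_sum_children[OF less.prems]
    unfolding s_def c_def by linarith
  ultimately show ?case
    by (rule has_pebbles_le)
qed

theorem exists_finprod_eq_one_cross_number_le_1:
  assumes "finite I" "order G \<le> card I" "g \<in> I \<rightarrow> carrier G"
  shows "\<exists>K. K \<noteq> {} \<and> K \<subseteq> I \<and> finprod G g K = \<one> \<and> cross_number g K \<le> 1"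
proof -
  have "g \<in> I \<rightarrow> elements_above {\<one>}"
    using assms(3) generate.one by (auto simp: elements_above_def)
  then have "has_pebbles g {\<one>} I (min 1 (card I - card (elements_strictly_above {\<one>})))"
    using has_pebbles_min_card[OF triv_subgroup assms(1)] by simp
  moreover have "card (elements_strictly_above {\<one>}) < card I"
  proof -
    have "\<one> \<notin> elements_strictly_above {\<one>}"
      using generate_one by (simp add: elements_strictly_above_def)
    then have "elements_strictly_above {\<one>} \<subset> carrier G"
      unfolding elements_strictly_above_def by blast
    then have "card (elements_strictly_above {\<one>}) < order G"
      unfolding order_def by (rule psubset_card_mono[OF finite_carrier])
    then show ?thesis
      using assms(2) by simp
  qed
  ultimately have "has_pebbles g {\<one>} I 1"
    by (simp add: min_def Suc_le_eq)
  then show ?thesis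
    by (auto simp: has_pebbles_def pebble_def)
qed

end

theorem theorem5:
  fixes p m :: nat and e :: "nat \<Rightarrow> nat" and G :: "(nat \<Rightarrow> int) monoid"
  assumes "Factorial_Ring.prime p"
    and "m \<ge> 1"
    and "antimono_on {1..m} e"
    and "\<forall>j\<in>{1..m}. e j \<ge> 1"
    and "G = sum_group {1..m} (\<lambda>j. integer_mod_group (p ^ e j))"
  shows "order G = (\<Prod>j=1..m. p ^ e j) \<and>
    (\<forall>g \<in> {1..order G} \<rightarrow> carrier G.
       \<exists>K. K \<noteq> {} \<and> K \<subseteq> {1..order G} \<and>
           finprod G g K = \<one>\<^bsub>G\<^esub> \<and>
           (\<Sum>k\<in>K. 1 / real (group.ord G (g k))) \<le> 1)"
proof
  have "p > 0"
    using assms(1) prime_gt_0_nat by blast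
  then have "order (integer_mod_group (p ^ e j)) = p ^ e j" for j
    by (simp add: order_def carrier_integer_mod_group flip: of_nat_power)
  then show ord: "order G = (\<Prod>j=1..m. p ^ e j)"
    by (simp add: assms(5) order_sum_group)
  interpret comm_group G
    unfolding assms(5) by (rule comm_group_sum_group) simp
  interpret finite_abelian_p_group G p "\<Sum>j=1..m. e j"
    by unfold_locales (simp_all add: assms(1) ord power_sum)
  show "\<forall>g \<in> {1..order G} \<rightarrow> carrier G.
       \<exists>K. K \<noteq> {} \<and> K \<subseteq> {1..order G} \<and>
           finprod G g K = \<one>\<^bsub>G\<^esub> \<and>
           (\<Sum>k\<in>K. 1 / real (group.ord G (g k))) \<le> 1"
    by (intro ballI exists_finprod_eq_one_cross_number_le_1[unfolded cross_number_def]) auto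
qed

end
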